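(* Let $S$ be a finite non-empty set and let $P=(p_{i,j})_{i,j\in S}$ be an irreducible stochastic matrix on $S$. Let $\mathcal{L}_P$ be the set of probability measures on the set of functions $S\to S$ that are consistent with $P$. Then $|\mathcal{L}_P|\ge 2$ if and only if $P$ has at least two rows each of which contains some entry lying in the open interval $(0,1)$.
   Context: Let $\mathcal{F}_S$ be the set of all functions from $S$ to $S$. A probability measure $\mu$ on $\mathcal{F}_S$ is consistent with $P$ if $p_{i,j}=\mu(\{f\in\mathcal{F}_S: f(i)=j\})$ for all $i,j\in S$. $\mathcal{L}_P$ denotes the set of all probability measures on $\mathcal{F}_S$ consistent with $P$. *)

theory Defs
  imports "HOL-Probability.Probability" "HOL-Library.Equipollence"
begin

text \<open>The finite non-empty set \<open>S\<close> is the universe of a type \<open>'s\<close> of class \<open>finite\<close>;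
  the entry \<open>p\<^sub>i\<^sub>j\<close> of \<open>P\<close> is \<open>P $ i $ j\<close>.\<close>

definition stochastic_matrix :: "real ^ 's ^ 's \<Rightarrow> bool" where
  "stochastic_matrix P \<longleftrightarrow>
     (\<forall>i j. 0 \<le> P $ i $ j) \<and> (\<forall>i. (\<Sum>j\<in>UNIV. P $ i $ j) = 1)"

text \<open>The library power \<open>(^)\<close> on vectors is componentwise; this is the power with
  respect to the matrix product.\<close>

primrec matrix_power :: "real ^ 's ^ 's \<Rightarrow> nat \<Rightarrow> real ^ 's ^ 's" where
  "matrix_power A 0 = mat 1"
| "matrix_power A (Suc n) = A ** matrix_power A n"

definition irreducible_matrix :: "real ^ 's ^ 's \<Rightarrow> bool" where
  "irreducible_matrix P \<longleftrightarrow> (\<forall>i j. \<exists>n\<ge>1. 0 < matrix_power P n $ i $ j)"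

text \<open>As \<open>'s \<Rightarrow> 's\<close> is finite, its \<open>\<sigma>\<close>-algebra is the full power set; equality of such
  \<open>measure\<close>s is then equality on all sets of functions.\<close>

definition consistent_measures :: "real ^ 's ^ 's \<Rightarrow> ('s \<Rightarrow> 's) measure set" where
  "consistent_measures P =
     {\<mu>. prob_space \<mu> \<and> sets \<mu> = UNIV \<and>
         (\<forall>i j. P $ i $ j = measure \<mu> {f. f i = j})}"

end

theory Submission
  imports Defs
begin

text \<open>If two rows \<open>a \<noteq> b\<close> have entries \<open>P\<^sub>a\<^sub>j, P\<^sub>b\<^sub>k\<close> in \<open>(0,1)\<close>, then under the product measure, which makes
  the values \<open>f i\<close> independent, the centred indicators of \<open>f a = j\<close> and \<open>f b = k\<close> are independent,
  bounded by 1 and of mean zero. Multiplying the product measure by 1 plus their product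
  therefore changes it without changing any marginal. Conversely, if all rows except the \<open>a\<close>-th are
  deterministic, a consistent measure is concentrated on functions determined by their value at
  \<open>a\<close>, so that the \<open>a\<close>-th marginal determines it.\<close>

text \<open>Having at least two elements is expressed by an injection because \<open>card\<close>
  would return 0 on an infinite set of measures.\<close>

lemma two_lepoll_iff: "{..<2::nat} \<lesssim> A \<longleftrightarrow> (\<exists>x\<in>A. \<exists>y\<in>A. x \<noteq> y)"
proof
  assume "{..<2::nat} \<lesssim> A"
  then obtain f where "inj_on f {..<2::nat}" "f ` {..<2} \<subseteq> A"
    by (auto simp: lepoll_def)
  then have "f 0 \<noteq> f 1" "f 0 \<in> A" "f 1 \<in> A"
    using inj_on_eq_iff[of f "{..<2}" 0 1] by auto
  then show "\<exists>x\<in>A. \<exists>y\<in>A. x \<noteq> y" by blast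
next
  assume "\<exists>x\<in>A. \<exists>y\<in>A. x \<noteq> y"
  then obtain x y where "x \<in> A" "y \<in> A" "x \<noteq> y" by blast
  then have "inj_on (\<lambda>n::nat. if n = 0 then x else y) {..<2}"
    "(\<lambda>n::nat. if n = 0 then x else y) ` {..<2} \<subseteq> A"
    by (auto simp: inj_on_def less_2_cases_iff)
  then show "{..<2::nat} \<lesssim> A" unfolding lepoll_def by blast
qed

text \<open>Fixing the value at \<open>i\<close> leaves all other values free, so the functions
  summed over form a product set and the sum factors over the rows. It yields the marginals of a
  product weight, and shows that they vanish when another row has weight sum zero.\<close>

lemma sum_prod_fixed_value:
  fixes W :: "'a::finite \<Rightarrow> 'b::finite \<Rightarrow> real"
  shows "(\<Sum>f | f i = j. \<Prod>k\<in>UNIV. W k (f k)) = W i j * (\<Prod>k\<in>UNIV - {i}. \<Sum>x\<in>UNIV. W k x)"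
proof -
  define A where "A k = (if k = i then {j} else UNIV)" for k
  have "{f. f i = j} = PiE UNIV A"
    by (auto simp: A_def PiE_def Pi_def split: if_splits)
  then have "(\<Sum>f | f i = j. \<Prod>k\<in>UNIV. W k (f k)) = (\<Prod>k\<in>UNIV. \<Sum>x\<in>A k. W k x)"
    by (subst prod_sum_PiE) (auto simp: A_def)
  also have "\<dots> = (\<Sum>x\<in>A i. W i x) * (\<Prod>k\<in>UNIV - {i}. \<Sum>x\<in>A k. W k x)"
    by (rule prod.remove) auto
  also have "\<dots> = W i j * (\<Prod>k\<in>UNIV - {i}. \<Sum>x\<in>UNIV. W k x)"
    by (simp add: A_def)
  finally show ?thesis .
qed

lemma point_measure_consistent:
  fixes P :: "real ^ 's ^ 's"
  assumes P: "stochastic_matrix P"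
    and nn: "\<And>f. 0 \<le> m f"
    and marg: "\<And>i j. (\<Sum>f | f i = j. m f) = P $ i $ j"
  shows "point_measure UNIV (\<lambda>f. ennreal (m f)) \<in> consistent_measures P"
proof -
  let ?M = "point_measure UNIV (\<lambda>f. ennreal (m f))"
  have em: "emeasure ?M A = ennreal (\<Sum>f\<in>A. m f)" for A
    by (simp add: emeasure_point_measure_finite nn)
  fix i :: 's
  \<comment> \<open>Total mass 1 follows from the marginals: grouping the functions by their value
    at any single \<open>i\<close> gives a row sum of \<open>P\<close>.\<close>
  have "(\<Sum>f\<in>UNIV. m f) = (\<Sum>j\<in>UNIV. \<Sum>f | f i = j. m f)"
    using sum.group[of "UNIV :: ('s \<Rightarrow> 's) set" UNIV "\<lambda>f. f i" m] by simp
  also have "\<dots> = 1"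
    using P by (simp add: marg stochastic_matrix_def)
  finally have "prob_space ?M"
    by (intro prob_spaceI) (simp add: em space_point_measure)
  moreover have "measure ?M {f. f i = j} = P $ i $ j" for i j
    by (simp add: measure_def em marg[symmetric] sum_nonneg nn)
  ultimately show ?thesis
    by (simp add: consistent_measures_def sets_point_measure)
qed

lemma two_random_rows_imp_two_measures:
  fixes P :: "real ^ 's ^ 's"
  assumes P: "stochastic_matrix P"
    and ab: "a \<noteq> b" and aj: "P $ a $ j \<in> {0<..<1}" and bk: "P $ b $ k \<in> {0<..<1}"
  shows "\<exists>\<mu>\<in>consistent_measures P. \<exists>\<nu>\<in>consistent_measures P. \<mu> \<noteq> \<nu>"
proof -
  have P0: "0 \<le> P $ i $ x" and P1: "(\<Sum>x\<in>UNIV. P $ i $ x) = 1" for i x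
    using P by (auto simp: stochastic_matrix_def)
  \<comment> \<open>The value 1 off the rows \<open>a\<close> and \<open>b\<close> makes the
    perturbation \<open>d\<close> below a single product over all rows, as
    \<open>sum_prod_fixed_value\<close> requires.\<close>
  define \<phi> where "\<phi> i x =
    (if i = a then of_bool (x = j) - P $ a $ j
     else if i = b then of_bool (x = k) - P $ b $ k else 1)" for i x
  define p where "p f = (\<Prod>i\<in>UNIV. P $ i $ f i)" for f
  define d where "d f = (\<Prod>i\<in>UNIV. P $ i $ f i * \<phi> i (f i))" for f
  have p_marg: "(\<Sum>f | f i = x. p f) = P $ i $ x" for i x
    using sum_prod_fixed_value[of "\<lambda>i x. P $ i $ x" i x] by (simp add: p_def P1)
  have mean0: "(\<Sum>x\<in>UNIV. P $ i $ x * \<phi> i x) = 0" if "i = a \<or> i = b" for i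
  proof -
    have "(\<Sum>x\<in>UNIV. P $ i $ x * (of_bool (x = y) - P $ i $ y)) = 0" for y
    proof -
      have "(\<Sum>x\<in>UNIV. P $ i $ x * (of_bool (x = y) - P $ i $ y))
        = (\<Sum>x\<in>UNIV. P $ i $ x * of_bool (x = y)) - (\<Sum>x\<in>UNIV. P $ i $ x) * P $ i $ y"
        by (simp add: right_diff_distrib sum_subtractf sum_distrib_right)
      also have "\<dots> = 0"
        by (simp add: P1 of_bool_def if_distrib cong: if_cong)
      finally show ?thesis .
    qed
    then show ?thesis using that ab by (auto simp: \<phi>_def)
  qed
  have d_marg: "(\<Sum>f | f i = x. d f) = 0" for i x
  proof -
    \<comment> \<open>Whichever row \<open>i\<close> is fixed, at least one of \<open>a\<close> and
      \<open>b\<close> remains among the others; \<open>c\<close> is such a row, and its mean-zero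
      factor annihilates the product.\<close>
    define c where "c = (if i = a then b else a)"
    have "c \<in> UNIV - {i}" "c = a \<or> c = b" using ab by (auto simp: c_def)
    then have "(\<Prod>i\<in>UNIV - {i}. \<Sum>x\<in>UNIV. P $ i $ x * \<phi> i x) = 0"
      using mean0[of c] by (intro prod_zero) auto
    then show ?thesis
      using sum_prod_fixed_value[of "\<lambda>i x. P $ i $ x * \<phi> i x" i x] by (simp add: d_def)
  qed
  have \<phi>_le: "\<bar>\<phi> i x\<bar> \<le> 1" for i x
    using aj bk by (auto simp: \<phi>_def of_bool_def)
  have p_nn: "0 \<le> p f" for f
    by (simp add: p_def prod_nonneg P0)
  have "\<bar>d f\<bar> \<le> p f" for f
    unfolding d_def p_def abs_prod
    by (intro prod_mono) (simp add: abs_mult P0 \<phi>_le mult_left_le)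
  then have pd_nn: "0 \<le> p f + d f" for f
    using abs_le_D2[of "d f" "p f"] by simp
  have "\<forall>i. \<exists>x. P $ i $ x > 0"
  proof
    fix i
    show "\<exists>x. P $ i $ x > 0"
    proof (rule ccontr)
      assume "\<not> ?thesis"
      then have "(\<Sum>x\<in>UNIV. P $ i $ x) \<le> 0" by (intro sum_nonpos) (auto simp: not_less)
      then show False by (simp add: P1)
    qed
  qed
  then obtain g where g: "\<And>i. P $ i $ g i > 0" by metis
  \<comment> \<open>At \<open>f\<close> both indicators are 1, so the centred factors are
    \<open>1 - P $ a $ j\<close> and \<open>1 - P $ b $ k\<close>, both positive; \<open>g\<close>
    keeps the factors of the other rows positive.\<close>
  define f where "f = g(a := j, b := k)"
  have "P $ i $ f i * \<phi> i (f i) > 0" for i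
    using g[of i] aj bk ab by (auto simp: f_def \<phi>_def)
  then have d_pos: "d f > 0"
    by (simp add: d_def prod_pos)
  let ?\<mu> = "point_measure UNIV (\<lambda>f. ennreal (p f))"
  let ?\<nu> = "point_measure UNIV (\<lambda>f. ennreal (p f + d f))"
  have "?\<mu> \<in> consistent_measures P"
    by (rule point_measure_consistent[OF P p_nn p_marg])
  moreover have "?\<nu> \<in> consistent_measures P"
    by (rule point_measure_consistent[OF P pd_nn]) (simp add: sum.distrib p_marg d_marg)
  moreover have "?\<mu> \<noteq> ?\<nu>"
  proof
    assume "?\<mu> = ?\<nu>"
    then have "emeasure ?\<mu> {f} = emeasure ?\<nu> {f}" by simp
    then show False
      using d_pos p_nn[of f] by (simp add: emeasure_point_measure_finite)
  qed
  ultimately show ?thesis by blast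
qed

text \<open>Almost surely \<open>f i = h i\<close> for each of the finitely many
  \<open>i \<noteq> a\<close>, hence \<open>f = h(a := f a)\<close>. The value \<open>h a\<close> is
  arbitrary, being overwritten. Since \<open>\<mu>\<close> does not occur on the right-hand side,
  this is a uniqueness statement.\<close>

lemma consistent_measure_eq:
  fixes P :: "real ^ 's ^ 's"
  assumes \<mu>: "\<mu> \<in> consistent_measures P"
    and h: "\<And>i. i \<noteq> a \<Longrightarrow> P $ i $ h i = 1"
  shows "measure \<mu> A = (\<Sum>x | h(a := x) \<in> A. P $ a $ x)"
proof -
  interpret prob_space \<mu> using \<mu> by (simp add: consistent_measures_def)
  have sets: "B \<in> sets \<mu>" for B
    using \<mu> by (simp add: consistent_measures_def)
  have space: "space \<mu> = UNIV"
    using sets.sets_into_space[OF sets[of UNIV]] by auto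
  have marg: "prob {f. f i = x} = P $ i $ x" for i x
    using \<mu> by (simp add: consistent_measures_def)
  have "AE f in \<mu>. f i = h i" if "i \<noteq> a" for i
    using prob_Collect_eq_1[of "\<lambda>f. f i = h i"] sets by (simp add: space marg h that)
  then have "AE f in \<mu>. \<forall>i\<in>UNIV - {a}. f i = h i"
    by (intro AE_finite_allI) auto
  then have "AE f in \<mu>. f = h(a := f a)"
    by eventually_elim auto
  then have "AE f in \<mu>. f \<in> A \<longleftrightarrow> f \<in> {f. h(a := f a) \<in> A}"
    by eventually_elim auto
  then have "prob A = prob {f. h(a := f a) \<in> A}"
    by (intro finite_measure_eq_AE sets)
  also have "{f. h(a := f a) \<in> A} = (\<Union>x\<in>{x. h(a := x) \<in> A}. {f. f a = x})"
    by auto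
  also have "prob \<dots> = (\<Sum>x | h(a := x) \<in> A. prob {f. f a = x})"
    by (intro finite_measure_finite_Union) (auto simp: sets disjoint_family_on_def)
  finally show ?thesis by (simp add: marg)
qed

text \<open>Nonnegative entries with sum 1 are at most 1, so if all avoid both the open interval and
  1, they vanish and cannot sum to 1.\<close>

lemma deterministic_row:
  fixes P :: "real ^ 's ^ 's"
  assumes P: "stochastic_matrix P" and det: "\<nexists>j. P $ i $ j \<in> {0<..<1}"
  shows "\<exists>j. P $ i $ j = 1"
proof (rule ccontr)
  assume no: "\<not> ?thesis"
  have P0: "\<And>j. 0 \<le> P $ i $ j" and P1: "(\<Sum>j\<in>UNIV. P $ i $ j) = 1"
    using P by (auto simp: stochastic_matrix_def)
  have "P $ i $ j = 0" for j
  proof -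
    have "P $ i $ j \<le> 1"
      using member_le_sum[of j UNIV "\<lambda>j. P $ i $ j"] P0 P1 by simp
    then show ?thesis using P0[of j] no det by (metis greaterThanLessThan_iff order_le_less)
  qed
  then show False using P1 by simp
qed

theorem theorem2p3:
  fixes P :: "real ^ 's ^ 's"
  assumes "stochastic_matrix P"
    and "irreducible_matrix P"
  shows "{..<2::nat} \<lesssim> consistent_measures P \<longleftrightarrow>
    card {i. \<exists>j. P $ i $ j \<in> {0<..<1}} \<ge> 2"
proof -
  let ?R = "{i. \<exists>j. P $ i $ j \<in> {0<..<1}}"
  show ?thesis
  proof (cases "card ?R \<ge> 2")
    case True
    then have "\<not> card ?R \<le> Suc 0" by simp
    then obtain a b where "a \<in> ?R" "b \<in> ?R" "a \<noteq> b"
      unfolding card_le_Suc0_iff_eq[OF finite[of ?R]] by blast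
    then show ?thesis
      using True two_random_rows_imp_two_measures[OF assms(1)] unfolding two_lepoll_iff by blast
  next
    case False
    then have "card ?R \<le> Suc 0" by simp
    \<comment> \<open>This form also covers an empty set of random rows, where any \<open>a\<close>
      serves.\<close>
    then have "\<exists>a. ?R \<subseteq> {a}"
      unfolding card_le_Suc0_iff_eq[OF finite[of ?R]] by blast
    then obtain a where "?R \<subseteq> {a}" by blast
    then have "\<forall>i. \<exists>j. i \<noteq> a \<longrightarrow> P $ i $ j = 1"
      using deterministic_row[OF assms(1)] by blast
    then obtain h where h: "\<And>i. i \<noteq> a \<Longrightarrow> P $ i $ h i = 1" by metis
    have "\<mu> = \<nu>" if "\<mu> \<in> consistent_measures P" "\<nu> \<in> consistent_measures P" for \<mu> \<nu>
    proof (rule measure_eqI)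
      show "sets \<mu> = sets \<nu>" using that by (simp add: consistent_measures_def)
      interpret \<mu>: prob_space \<mu> using that by (simp add: consistent_measures_def)
      interpret \<nu>: prob_space \<nu> using that by (simp add: consistent_measures_def)
      show "emeasure \<mu> A = emeasure \<nu> A" for A
        using consistent_measure_eq[OF that(1) h, where A = A] consistent_measure_eq[OF that(2) h, where A = A]
        by (simp add: \<mu>.emeasure_eq_measure \<nu>.emeasure_eq_measure)
    qed
    with False show ?thesis unfolding two_lepoll_iff by blast
  qed
qed

end
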